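(* Let $\Omega\subseteq\mathbb{C}$ be a reflection-symmetric set that is modulus-closed and such that $I:=\Omega\cap[0,\infty)$ is an interval. Let $f:\Omega\to\mathbb{C}$. Then the following are equivalent: (1) $f[A]$ is positive semidefinite for all positive semidefinite $A\in M_2(\Omega)$. (2) The following conditions hold: $f|_{I}$ is real-valued, nonnegative, nondecreasing, and multiplicatively midconvex; and for all $z\in\Omega$, we have $f(|z|)\geq|f(z)|$ and $f(\overline{z})=\overline{f(z)}$. Moreover, when these conditions hold, $f|_{I\setminus\{0\}}$ is either identically zero or never zero, except possibly at the upper-end point of $I$ (if it belongs to $I$). In particular, $f|_{I\setminus\{0\}}$ is continuous except possibly at the upper-end point of $I$ (if it belongs to $I$).
   Context: $M_n(\Omega)$ denotes the set of $n\times n$ matrices with entries in $\Omega$, and $f[A]:=(f(a_{ij}))$ for $A=(a_{ij})$. Positive semidefinite matrices are Hermitian by definition. $\Omega$ is reflection-symmetric if $z\in\Omega$ implies $\overline{z}\in\Omega$, and modulus-closed if $z\in\Omega$ implies $|z|\in\Omega$. A function $g:J\to[0,\infty)$ on an interval $J\subseteq[0,\infty)$ is multiplicatively midconvex if $\sqrt{g(x)g(y)}\geq g(\sqrt{xy})$ for all $x,y\in J$. *)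

theory Defs
  imports "HOL-Analysis.Analysis"
begin

definition hermitian_mat :: "complex ^ 'n ^ 'n \<Rightarrow> bool" where
  "hermitian_mat A \<longleftrightarrow> (\<forall>i j. A $ i $ j = cnj (A $ j $ i))"

definition psd :: "complex ^ 'n ^ 'n \<Rightarrow> bool" where
  "psd A \<longleftrightarrow> hermitian_mat A \<and>
     (\<forall>v :: complex ^ 'n. (\<Sum>i\<in>UNIV. \<Sum>j\<in>UNIV. cnj (v $ i) * A $ i $ j * v $ j) \<in> \<real>\<^sub>\<ge>\<^sub>0)"

definition matrices_over :: "'a set \<Rightarrow> ('a ^ 'n ^ 'n) set" where
  "matrices_over \<Omega> = {A. \<forall>i j. A $ i $ j \<in> \<Omega>}"

definition reflection_symmetric :: "complex set \<Rightarrow> bool" where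
  "reflection_symmetric \<Omega> \<longleftrightarrow> (\<forall>z\<in>\<Omega>. cnj z \<in> \<Omega>)"

definition modulus_closed :: "complex set \<Rightarrow> bool" where
  "modulus_closed \<Omega> \<longleftrightarrow> (\<forall>z\<in>\<Omega>. complex_of_real (cmod z) \<in> \<Omega>)"

(* The set \<Omega> \<inter> [0,\<infinity>), as a set of real numbers. *)
definition nonneg_part :: "complex set \<Rightarrow> real set" where
  "nonneg_part \<Omega> = {x. 0 \<le> x \<and> complex_of_real x \<in> \<Omega>}"

(* Meant for nonnegative g on an interval J of nonnegative reals, where sqrt (x * y)
   lies again in J; sqrt of a negative number is not the intended square root. *)
definition mult_midconvex_on :: "real set \<Rightarrow> (real \<Rightarrow> real) \<Rightarrow> bool" where
  "mult_midconvex_on J g \<longleftrightarrow> (\<forall>x\<in>J. \<forall>y\<in>J. sqrt (g x * g y) \<ge> g (sqrt (x * y)))"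

(* The upper end point of an interval J that belongs to J, i.e. the greatest element of J;
   no x qualifies if J is unbounded above or does not contain its supremum. *)
definition is_upper_end :: "real set \<Rightarrow> real \<Rightarrow> bool" where
  "is_upper_end J x \<longleftrightarrow> x \<in> J \<and> (\<forall>y\<in>J. y \<le> x)"

end

theory Submission
  imports Defs "HOL-Real_Asymp.Real_Asymp"
begin

text \<open>
  A \<open>2 \<times> 2\<close> Hermitian matrix with diagonal \<open>a, d\<close> and off-diagonal entry \<open>z\<close> is positive semidefinite
  iff \<open>a, d \<ge> 0\<close> and \<open>\<bar>z\<bar>\<^sup>2 \<le> a d\<close>. Each condition in (2) comes from one test matrix: the diagonal
  \<open>y, y\<close> with off-diagonal \<open>x \<le> y\<close> gives monotonicity, the diagonal \<open>x, y\<close> with off-diagonal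
  \<open>\<surd>(x y)\<close> gives midconvexity, and the diagonal \<open>\<bar>z\<bar>, \<bar>z\<bar>\<close> with off-diagonal \<open>z\<close> gives the rest.
  Conversely \<open>\<bar>f z\<bar> \<le> f \<bar>z\<bar> \<le> f (\<surd>(a d)) \<le> \<surd>(f a f d)\<close>. Continuity at \<open>x\<close> from the right follows from
  midconvexity applied to \<open>x\<close> and \<open>w \<down> x\<close>, and from the left by applying it to \<open>t \<up> x\<close> and \<open>x\<^sup>2 / t\<close>,
  whose geometric mean is \<open>x\<close>.
\<close>

section \<open>Positive semidefinite matrices of size two\<close>

lemma psd_2_iff:
  fixes A :: "complex ^ 2 ^ 2"
  shows "psd A \<longleftrightarrow> A $ 1 $ 1 \<in> \<real>\<^sub>\<ge>\<^sub>0 \<and> A $ 2 $ 2 \<in> \<real>\<^sub>\<ge>\<^sub>0 \<and> A $ 2 $ 1 = cnj (A $ 1 $ 2) \<and>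
    (cmod (A $ 1 $ 2))\<^sup>2 \<le> Re (A $ 1 $ 1) * Re (A $ 2 $ 2)"
    (is "_ \<longleftrightarrow> ?R")
proof
  let ?q = "\<lambda>v :: complex ^ 2. \<Sum>i\<in>UNIV. \<Sum>j\<in>UNIV. cnj (v $ i) * A $ i $ j * v $ j"
  define z where "z = A $ 1 $ 2"
  assume "psd A"
  then have q: "\<And>v. ?q v \<in> \<real>\<^sub>\<ge>\<^sub>0"
    and herm: "\<And>i j. A $ i $ j = cnj (A $ j $ i)"
    unfolding psd_def hermitian_mat_def by blast+
  have d1: "A $ 1 $ 1 \<in> \<real>\<^sub>\<ge>\<^sub>0" using q[of "vector [1, 0]"] by (simp add: sum_2)
  have d2: "A $ 2 $ 2 \<in> \<real>\<^sub>\<ge>\<^sub>0" using q[of "vector [0, 1]"] by (simp add: sum_2)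
  obtain a where a: "A $ 1 $ 1 = complex_of_real a" "a \<ge> 0" using d1 nonneg_Reals_cases by metis
  obtain d where d: "A $ 2 $ 2 = complex_of_real d" "d \<ge> 0" using d2 nonneg_Reals_cases by metis
  have z: "A $ 1 $ 2 = z" "A $ 2 $ 1 = cnj z" using herm[of 2 1] by (simp_all add: z_def)
  have n: "(cmod z)\<^sup>2 = (Re z)\<^sup>2 + (Im z)\<^sup>2" by (simp add: cmod_power2)
  \<comment> \<open>The first row of \<open>A\<close> annihilates this test vector and the second
    row annihilates the next one, so the form collapses to a diagonal entry times the
    determinant.\<close>
  have "0 \<le> a * (a * d - (cmod z)\<^sup>2)"
    using q[of "vector [z, - of_real a]"] unfolding n
    by (simp add: sum_2 a d z complex_nonneg_Reals_iff power2_eq_square algebra_simps)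
  moreover have "0 \<le> d * (a * d - (cmod z)\<^sup>2)"
    using q[of "vector [of_real d, - cnj z]"] unfolding n
    by (simp add: sum_2 a d z complex_nonneg_Reals_iff power2_eq_square algebra_simps)
  \<comment> \<open>Covers \<open>a = d = 0\<close>, where the two previous inequalities are
    vacuous: here it forces \<open>z = 0\<close>.\<close>
  moreover have "2 * (cmod z)\<^sup>2 \<le> a * (cmod z)\<^sup>2 + d"
    using q[of "vector [z, - 1]"] unfolding n
    by (simp add: sum_2 a d z complex_nonneg_Reals_iff power2_eq_square algebra_simps)
  ultimately have "(cmod z)\<^sup>2 \<le> a * d"
    using a(2) d(2) by (cases "a = 0"; cases "d = 0") (auto simp: zero_le_mult_iff mult_le_0_iff)
  then show ?R using d1 d2 by (simp add: a d z)
next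
  assume R: ?R
  obtain a where a: "A $ 1 $ 1 = complex_of_real a" "a \<ge> 0" using R nonneg_Reals_cases by metis
  obtain d where d: "A $ 2 $ 2 = complex_of_real d" "d \<ge> 0" using R nonneg_Reals_cases by metis
  define z where "z = A $ 1 $ 2"
  have z: "A $ 1 $ 2 = z" "A $ 2 $ 1 = cnj z" using R by (simp_all add: z_def)
  have zle: "cmod z \<le> sqrt a * sqrt d"
    using R by (simp add: a d z real_le_rsqrt flip: real_sqrt_mult)
  have "(\<Sum>i\<in>UNIV. \<Sum>j\<in>UNIV. cnj (v $ i) * A $ i $ j * v $ j) \<in> \<real>\<^sub>\<ge>\<^sub>0" for v :: "complex ^ 2"
  proof -
    define p q w where "p = cmod (v $ 1)" and "q = cmod (v $ 2)" and "w = cnj (v $ 1) * z * v $ 2"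
    have eq: "(\<Sum>i\<in>UNIV. \<Sum>j\<in>UNIV. cnj (v $ i) * A $ i $ j * v $ j) =
        of_real (a * p\<^sup>2 + d * q\<^sup>2 + 2 * Re w)"
    proof -
      have "(\<Sum>i\<in>UNIV. \<Sum>j\<in>UNIV. cnj (v $ i) * A $ i $ j * v $ j) =
          of_real a * (v $ 1 * cnj (v $ 1)) + of_real d * (v $ 2 * cnj (v $ 2)) + (w + cnj w)"
        by (simp add: sum_2 a d z w_def algebra_simps)
      also have "\<dots> = of_real (a * p\<^sup>2 + d * q\<^sup>2 + 2 * Re w)"
        unfolding complex_add_cnj p_def q_def
        by (simp only: of_real_add of_real_mult complex_norm_square)
      finally show ?thesis .
    qed
    \<comment> \<open>The cross term \<open>2 * Re w\<close> is at least minus twice this bound, and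
      expanding the square below shows that the diagonal terms compensate for it.\<close>
    have "cmod w \<le> (sqrt a * sqrt d) * (p * q)"
      using mult_right_mono[OF zle, of "p * q"]
      by (simp add: w_def p_def q_def norm_mult mult_ac)
    then have "- Re w \<le> (sqrt a * sqrt d) * (p * q)"
      using abs_Re_le_cmod[of w] by linarith
    moreover have "0 \<le> (sqrt a * p - sqrt d * q)\<^sup>2" by simp
    ultimately have "0 \<le> a * p\<^sup>2 + d * q\<^sup>2 + 2 * Re w"
      using a(2) d(2) by (simp add: power2_diff power_mult_distrib mult_ac)
    then show ?thesis unfolding eq by (simp only: nonneg_Reals_of_real_iff)
  qed
  moreover have "hermitian_mat A"
    by (simp add: hermitian_mat_def forall_2 a d z)
  ultimately show "psd A" by (simp add: psd_def)
qed

section \<open>Geometric means in an interval\<close>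

lemma sqrt_mult_between:
  fixes x y :: real
  assumes "0 \<le> x" "x \<le> y"
  shows "x \<le> sqrt (x * y)" "sqrt (x * y) \<le> y"
proof -
  show "x \<le> sqrt (x * y)"
    using assms by (intro real_le_rsqrt) (simp add: power2_eq_square mult_left_mono)
  show "sqrt (x * y) \<le> y"
    using assms by (intro real_le_lsqrt) (auto simp: power2_eq_square mult_right_mono)
qed

lemma sqrt_mult_mem_interval:
  fixes J :: "real set"
  assumes "is_interval J" "x \<in> J" "y \<in> J" "0 \<le> x" "0 \<le> y"
  shows "sqrt (x * y) \<in> J"
proof (cases "x \<le> y")
  case True
  then show ?thesis using assms sqrt_mult_between[of x y] mem_is_interval_1_I by blast
next
  case False
  then show ?thesis
    using assms sqrt_mult_between[of y x] mem_is_interval_1_I[of J y x] by (simp add: mult.commute)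
qed

section \<open>Monotone multiplicatively midconvex functions\<close>

text \<open>Isolates the real-variable content of condition (2). It is interpreted for
  \<open>I\<close> and the real part of \<open>f\<close> in the implication from (2) to (1) and
  again for the claims on zeros and continuity.\<close>

locale mono_mult_midconvex =
  fixes J :: "real set" and g :: "real \<Rightarrow> real"
  assumes interval: "is_interval J"
    and J_nonneg: "x \<in> J \<Longrightarrow> 0 \<le> x"
    and g_nonneg: "x \<in> J \<Longrightarrow> 0 \<le> g x"
    and mono: "mono_on J g"
    and midconvex: "mult_midconvex_on J g"
begin

lemma le_mono: "x \<in> J \<Longrightarrow> y \<in> J \<Longrightarrow> x \<le> y \<Longrightarrow> g x \<le> g y"
  using mono by (rule mono_onD)

lemma sqrt_mem: "x \<in> J \<Longrightarrow> y \<in> J \<Longrightarrow> sqrt (x * y) \<in> J"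
  using interval J_nonneg sqrt_mult_mem_interval by blast

lemma midconvex_square: "x \<in> J \<Longrightarrow> y \<in> J \<Longrightarrow> (g (sqrt (x * y)))\<^sup>2 \<le> g x * g y"
  using midconvex g_nonneg sqrt_mem unfolding mult_midconvex_on_def
  by (metis mult_nonneg_nonneg power_mono real_sqrt_pow2)

text \<open>Geometric means with a point \<open>w\<close> beyond \<open>y\<close> push the zero from \<open>x\<close> up to points arbitrarily
  close to \<open>w\<close>.\<close>

lemma zero_propagates:
  assumes x: "x \<in> J" "0 < x" "g x = 0" and y: "y \<in> J" "\<not> is_upper_end J y"
  shows "g y = 0"
proof -
  obtain w where w: "w \<in> J" "y < w"
    using y unfolding is_upper_end_def by force
  have y0: "0 \<le> y" using y J_nonneg by blast
  show ?thesis
  proof (cases "y \<le> x")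
    case True
    then show ?thesis using le_mono[of y x] g_nonneg[of y] x y by auto
  next
    case False
    have w0: "0 < w" using y0 w by simp
    \<comment> \<open>On the logarithmic scale each step halves the distance to \<open>w\<close>, so
      some \<open>u n\<close> exceeds \<open>y\<close>.\<close>
    define u where "u = rec_nat x (\<lambda>_ t. sqrt (t * w))"
    have u0: "u 0 = x" and uS: "u (Suc n) = sqrt (u n * w)" for n by (simp_all add: u_def)
    have u: "u n \<in> J \<and> 0 < u n \<and> g (u n) = 0" for n
    proof (induction n)
      case 0
      then show ?case using x by (simp add: u0)
    next
      case (Suc n)
      then show ?case
        using midconvex_square[of "u n" w] sqrt_mem[of "u n" w] w w0 by (simp add: uS)
    qed
    have ln: "ln w - ln (u n) = (ln w - ln x) / 2 ^ n" for n
    proof (induction n)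
      case 0
      then show ?case by (simp add: u0)
    next
      case (Suc n)
      have "ln w - ln (u (Suc n)) = (ln w - ln (u n)) / 2"
        using u[of n] w0 by (simp add: uS ln_sqrt ln_mult field_simps)
      then show ?case using Suc by simp
    qed
    have "(\<lambda>n. (ln w - ln x) / 2 ^ n) \<longlonglongrightarrow> 0"
      by real_asymp
    moreover have "0 < ln w - ln y" using w y0 False x by simp
    ultimately have "eventually (\<lambda>n. (ln w - ln x) / 2 ^ n < ln w - ln y) sequentially"
      by (rule order_tendstoD)
    then obtain n where "(ln w - ln x) / 2 ^ n < ln w - ln y"
      unfolding eventually_sequentially by blast
    then have "ln y < ln (u n)" using ln[of n] by linarith
    then have "y \<le> u n" using u[of n] False x by simp
    then show ?thesis using le_mono[of y "u n"] u[of n] g_nonneg[of y] y by auto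
  qed
qed

text \<open>The infimum \<open>r\<close> of \<open>g\<close> to the right of \<open>x\<close> satisfies \<open>r\<^sup>2 \<le> g x * r\<close>, since \<open>sqrt (x * w)\<close> lies to the
  right of \<open>x\<close> whenever \<open>w\<close> does.\<close>

lemma right_approx:
  assumes x: "x \<in> J" "0 < x" "\<not> is_upper_end J x" and e: "0 < e"
  shows "\<exists>w\<in>J. x < w \<and> g w < g x + e"
proof (rule ccontr)
  assume "\<not> ?thesis"
  then have far: "g x + e \<le> g w" if "w \<in> J" "x < w" for w using that by force
  define S where "S = g ` {w \<in> J. x < w}"
  have "S \<noteq> {}" using x unfolding is_upper_end_def S_def by force
  define r where "r = Inf S"
  have bdd: "bdd_below S" unfolding S_def using g_nonneg by (intro bdd_belowI[of _ 0]) auto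
  have r: "g x + e \<le> r" unfolding r_def
    using \<open>S \<noteq> {}\<close> by (rule cInf_greatest) (auto simp: S_def far)
  have rpos: "0 < r" using r e g_nonneg[OF x(1)] by linarith
  have r2: "r\<^sup>2 \<le> g x * g w" if w: "w \<in> J" "x < w" for w
  proof -
    have "x < sqrt (x * w)" using w x by (intro real_less_rsqrt) (simp add: power2_eq_square)
    then have "r \<le> g (sqrt (x * w))"
      unfolding r_def using sqrt_mem[OF x(1) w(1)] by (intro cInf_lower bdd) (auto simp: S_def)
    then have "r\<^sup>2 \<le> (g (sqrt (x * w)))\<^sup>2" using rpos by (intro power_mono) auto
    then show ?thesis using midconvex_square[OF x(1) w(1)] by linarith
  qed
  obtain w0 where "w0 \<in> J" "x < w0" using \<open>S \<noteq> {}\<close> by (auto simp: S_def)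
  \<comment> \<open>If \<open>g x\<close> vanished, \<open>r2\<close> would give
    \<open>r\<^sup>2 \<le> 0\<close>. Hence one may divide by \<open>g x\<close>, and
    \<open>r\<^sup>2 / g x\<close> becomes a lower bound of \<open>S\<close>.\<close>
  then have "g x \<noteq> 0" using r2 rpos by fastforce
  then have gx: "0 < g x" using g_nonneg[OF x(1)] by simp
  have "r\<^sup>2 / g x \<le> r" unfolding r_def
    using \<open>S \<noteq> {}\<close> by (rule cInf_greatest) (use r2 gx in \<open>auto simp: S_def r_def field_simps\<close>)
  then have "r \<le> g x" using gx rpos by (simp add: field_simps power2_eq_square)
  then show False using r e by linarith
qed

text \<open>A single point \<open>w\<close> from \<open>right_approx\<close> controls both sides:
  monotonicity handles \<open>t\<close> between \<open>x\<close> and \<open>w\<close>, and the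
  reflection sending \<open>t\<close> to \<open>x\<^sup>2 / t\<close> carries points just left of
  \<open>x\<close> into that range.\<close>

lemma continuous_within:
  assumes x: "x \<in> J" "0 < x" "\<not> is_upper_end J x"
  shows "continuous (at x within J) g"
  unfolding continuous_within_eps_delta
proof (intro allI impI)
  fix e :: real assume e: "0 < e"
  obtain w where w: "w \<in> J" "x < w" "g w < g x + e" using right_approx[OF x e] by blast
  \<comment> \<open>The mirror image of \<open>w\<close>, chosen so that \<open>l < t < x\<close>
    gives \<open>x < s < w\<close> for the mirror image \<open>s\<close> of \<open>t\<close>. Only
    \<open>s\<close>, not \<open>l\<close>, has to lie in \<open>J\<close>.\<close>
  define l where "l = x\<^sup>2 / w"
  have l: "l < x" "0 < l" using w x by (simp_all add: l_def power2_eq_square field_simps)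
  have "dist (g t) (g x) < e" if t: "t \<in> J" "dist t x < min (w - x) (x - l)" for t
  proof (cases "x \<le> t")
    case True
    then have "t \<le> w" using t by (auto simp: dist_real_def)
    then show ?thesis
      using le_mono[OF x(1) t(1) True] le_mono[OF t(1) w(1)] w(3) by (simp add: dist_real_def)
  next
    case False
    then have tl: "l < t" "t < x" using t by (auto simp: dist_real_def)
    define s where "s = x\<^sup>2 / t"
    have t0: "0 < t" using tl l by linarith
    have s: "x < s" "s < w"
      using tl t0 w x by (simp_all add: s_def l_def power2_eq_square field_simps)
    have sJ: "s \<in> J" using mem_is_interval_1_I[OF interval x(1) w(1)] s by simp
    have "sqrt (t * s) = x" using t0 x by (simp add: s_def)
    then have "(g x)\<^sup>2 \<le> g t * g s" using midconvex_square[OF t(1) sJ] by simp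
    also have "\<dots> \<le> g t * (g x + e)"
      using le_mono[OF sJ w(1)] s w(3) g_nonneg[OF t(1)] by (intro mult_left_mono) auto
    finally have le: "(g x)\<^sup>2 \<le> g t * (g x + e)" .
    \<comment> \<open>Otherwise \<open>le\<close> would bound \<open>(g x)\<^sup>2\<close> by
      \<open>(g x - e) * (g x + e)\<close>, which is smaller by \<open>e * e\<close>.\<close>
    have "g x - e < g t"
    proof (rule ccontr)
      assume "\<not> ?thesis"
      then have "g t * (g x + e) \<le> (g x - e) * (g x + e)"
        using e g_nonneg[OF x(1)] by (intro mult_right_mono) auto
      moreover have "0 < e * e" using e by simp
      ultimately show False using le by (simp add: power2_eq_square algebra_simps)
    qed
    then show ?thesis using le_mono[OF t(1) x(1)] tl e by (simp add: dist_real_def)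
  qed
  then show "\<exists>d>0. \<forall>t\<in>J. dist t x < d \<longrightarrow> dist (g t) (g x) < e"
    using w l by (intro exI[of _ "min (w - x) (x - l)"]) auto
qed

end

section \<open>Test matrices and the equivalence\<close>

lemma nonneg_part_iff: "x \<in> nonneg_part \<Omega> \<longleftrightarrow> 0 \<le> x \<and> complex_of_real x \<in> \<Omega>"
  by (simp add: nonneg_part_def)

text \<open>Evaluates the preserver property at one matrix with diagonal \<open>a\<close>,
  \<open>d\<close> and off-diagonal entries \<open>z\<close>, \<open>cnj z\<close>; reflection
  symmetry keeps the latter in \<open>\<Omega>\<close>. Every part of (2) comes from a choice of
  these parameters.\<close>

lemma entrywise_psd_2D:
  assumes pres: "\<forall>A :: complex ^ 2 ^ 2. A \<in> matrices_over \<Omega> \<longrightarrow> psd A \<longrightarrow> psd (map_matrix f A)"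
    and "reflection_symmetric \<Omega>" "a \<in> nonneg_part \<Omega>" "d \<in> nonneg_part \<Omega>" "z \<in> \<Omega>" "(cmod z)\<^sup>2 \<le> a * d"
  shows "f (complex_of_real a) \<in> \<real>\<^sub>\<ge>\<^sub>0" "f (cnj z) = cnj (f z)"
    "(cmod (f z))\<^sup>2 \<le> Re (f (complex_of_real a)) * Re (f (complex_of_real d))"
proof -
  define A :: "complex ^ 2 ^ 2"
    where "A = vector [vector [of_real a, z], vector [cnj z, of_real d]]"
  have "A \<in> matrices_over \<Omega>" "psd A"
    using assms unfolding A_def
    by (auto simp: matrices_over_def psd_2_iff forall_2 nonneg_part_iff reflection_symmetric_def)
  then have "psd (map_matrix f A)" using pres by blast
  then show "f (complex_of_real a) \<in> \<real>\<^sub>\<ge>\<^sub>0" "f (cnj z) = cnj (f z)"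
    "(cmod (f z))\<^sup>2 \<le> Re (f (complex_of_real a)) * Re (f (complex_of_real d))"
    by (simp_all add: psd_2_iff A_def)
qed

theorem proposition2p3:
  fixes \<Omega> :: "complex set" and f :: "complex \<Rightarrow> complex" and I :: "real set"
  defines "I \<equiv> nonneg_part \<Omega>"
  assumes "reflection_symmetric \<Omega>"
    and "modulus_closed \<Omega>"
    and "is_interval I"
  shows
    "((\<forall>A :: complex ^ 2 ^ 2. A \<in> matrices_over \<Omega> \<longrightarrow> psd A \<longrightarrow> psd (map_matrix f A)) \<longleftrightarrow>
      ((\<forall>x\<in>I. f (complex_of_real x) \<in> \<real>) \<and>
       (\<forall>x\<in>I. 0 \<le> Re (f (complex_of_real x))) \<and>
       mono_on I (\<lambda>x. Re (f (complex_of_real x))) \<and>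
       mult_midconvex_on I (\<lambda>x. Re (f (complex_of_real x))) \<and>
       (\<forall>z\<in>\<Omega>. Re (f (complex_of_real (cmod z))) \<ge> cmod (f z) \<and> f (cnj z) = cnj (f z)))) \<and>
     ((\<forall>A :: complex ^ 2 ^ 2. A \<in> matrices_over \<Omega> \<longrightarrow> psd A \<longrightarrow> psd (map_matrix f A)) \<longrightarrow>
       ((\<forall>x\<in>I - {0}. \<not> is_upper_end I x \<longrightarrow> f (complex_of_real x) = 0) \<or>
        (\<forall>x\<in>I - {0}. \<not> is_upper_end I x \<longrightarrow> f (complex_of_real x) \<noteq> 0)) \<and>
       (\<forall>x\<in>I - {0}. \<not> is_upper_end I x \<longrightarrow>
          continuous (at x within I - {0}) (\<lambda>t. f (complex_of_real t))))"
    (is "(?P \<longleftrightarrow> ?C) \<and> (?P \<longrightarrow> ?Z \<and> ?K)")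
proof -
  define g where "g = (\<lambda>x. Re (f (complex_of_real x)))"
  have I: "x \<in> I \<longleftrightarrow> 0 \<le> x \<and> complex_of_real x \<in> \<Omega>" for x
    by (simp add: I_def nonneg_part_iff)
  have modI: "cmod z \<in> I" if "z \<in> \<Omega>" for z
    using that assms(3) by (simp add: I modulus_closed_def)
  have sqrtI: "sqrt (x * y) \<in> I" if "x \<in> I" "y \<in> I" for x y
    using that sqrt_mult_mem_interval[OF assms(4)] I by blast
  have PC: ?C if ?P
  proof -
    note D = entrywise_psd_2D[OF that assms(2), folded I_def]
    have nn: "f (complex_of_real x) \<in> \<real>\<^sub>\<ge>\<^sub>0" if "x \<in> I" for x
      using D(1)[of x x "of_real x"] that by (auto simp: I power2_eq_square)
    have g0: "0 \<le> g x" if "x \<in> I" for x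
      using nn[OF that] by (simp add: g_def complex_nonneg_Reals_iff)
    have re: "f (complex_of_real x) \<in> \<real>" if "x \<in> I" for x
      using nn[OF that] by (simp add: complex_nonneg_Reals_iff complex_is_Real_iff)
    \<comment> \<open>\<open>D(3)\<close> bounds a modulus of \<open>f\<close>; on \<open>I\<close>
      this turns it into an inequality for \<open>g\<close> itself.\<close>
    have gc: "cmod (f (complex_of_real x)) = g x" if "x \<in> I" for x
      using nn[OF that] by (simp add: g_def cmod_eq_Re complex_nonneg_Reals_iff)
    have "g x \<le> g y" if "x \<in> I" "y \<in> I" "x \<le> y" for x y
    proof -
      have "(g x)\<^sup>2 \<le> (g y)\<^sup>2"
        using D(3)[of y y "of_real x"] that gc[of x]
        by (simp add: I power2_eq_square mult_mono g_def)
      then show ?thesis using g0[OF that(2)] by (rule power2_le_imp_le)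
    qed
    then have "mono_on I g" by (intro mono_onI)
    moreover have "mult_midconvex_on I g"
      unfolding mult_midconvex_on_def
    proof (intro ballI)
      fix x y assume xy: "x \<in> I" "y \<in> I"
      have "(cmod (f (of_real (sqrt (x * y)))))\<^sup>2 \<le> g x * g y"
        using D(3)[of x y "of_real (sqrt (x * y))"] xy sqrtI[OF xy] by (simp add: I g_def)
      then show "g (sqrt (x * y)) \<le> sqrt (g x * g y)"
        using gc[OF sqrtI[OF xy]] by (simp add: real_le_rsqrt)
    qed
    moreover have "cmod (f z) \<le> g (cmod z) \<and> f (cnj z) = cnj (f z)" if "z \<in> \<Omega>" for z
    proof -
      have "(cmod (f z))\<^sup>2 \<le> (g (cmod z))\<^sup>2"
        using D(3)[of "cmod z" "cmod z" z] that modI[OF that] by (simp add: power2_eq_square g_def)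
      then have "cmod (f z) \<le> g (cmod z)"
        using g0[OF modI[OF that]] by (rule power2_le_imp_le)
      then show ?thesis
        using D(2)[of "cmod z" "cmod z" z] modI[OF that] that by (simp add: power2_eq_square)
    qed
    ultimately show ?C using re g0 by (simp add: g_def)
  qed
  have CP: ?P if ?C
  proof (intro allI impI)
    fix A :: "complex ^ 2 ^ 2"
    assume A: "A \<in> matrices_over \<Omega>" "psd A"
    have re: "f (complex_of_real x) = of_real (g x)" "0 \<le> g x" if "x \<in> I" for x
      using \<open>?C\<close> that by (auto simp: g_def)
    have mono: "mono_on I g" and mid: "mult_midconvex_on I g"
      and z: "\<And>z. z \<in> \<Omega> \<Longrightarrow> cmod (f z) \<le> g (cmod z) \<and> f (cnj z) = cnj (f z)"
      using \<open>?C\<close> by (auto simp: g_def)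
    interpret mono_mult_midconvex I g
      using assms(4) re(2) mono mid by unfold_locales (auto simp: I)
    note R = A(2)[unfolded psd_2_iff]
    obtain a where a: "A $ 1 $ 1 = complex_of_real a" "a \<ge> 0" using R nonneg_Reals_cases by metis
    obtain d where d: "A $ 2 $ 2 = complex_of_real d" "d \<ge> 0" using R nonneg_Reals_cases by metis
    have mem: "A $ i $ j \<in> \<Omega>" for i j using A(1) by (simp add: matrices_over_def)
    have aI: "a \<in> I" and dI: "d \<in> I" using mem[of 1 1] mem[of 2 2] a d by (simp_all add: I)
    let ?z = "A $ 1 $ 2"
    have "cmod ?z \<le> sqrt (a * d)" using R a d by (simp add: real_le_rsqrt)
    \<comment> \<open>Both arguments lie in \<open>I\<close>: the first by modulus closure, the
      second as a geometric mean of points of \<open>I\<close>.\<close>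
    then have "g (cmod ?z) \<le> g (sqrt (a * d))"
      using le_mono modI[OF mem] sqrtI[OF aI dI] by blast
    then have "cmod (f ?z) \<le> g (sqrt (a * d))" using z[OF mem, of 1 2] by linarith
    then have "(cmod (f ?z))\<^sup>2 \<le> (g (sqrt (a * d)))\<^sup>2" by (simp add: power_mono)
    also have "\<dots> \<le> g a * g d" using midconvex_square[OF aI dI] .
    finally show "psd (map_matrix f A)"
      using R a d re[OF aI] re[OF dI] z[OF mem, of 1 2] by (simp add: psd_2_iff)
  qed
  have "?Z \<and> ?K" if ?P
  proof
    note C = PC[OF that]
    have re: "f (complex_of_real x) = of_real (g x)" "0 \<le> g x" if "x \<in> I" for x
      using C that by (auto simp: g_def)
    have "mono_on I g" "mult_midconvex_on I g" using C by (auto simp: g_def)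
    then interpret mono_mult_midconvex I g
      using assms(4) re(2) by unfold_locales (auto simp: I)
    show ?Z
    proof (rule disjCI)
      assume "\<not> (\<forall>x\<in>I - {0}. \<not> is_upper_end I x \<longrightarrow> f (complex_of_real x) \<noteq> 0)"
      then obtain x where x: "x \<in> I" "x \<noteq> 0" "f (complex_of_real x) = 0" by blast
      then have "0 < x" "g x = 0" using J_nonneg[of x] by (simp_all add: g_def)
      then show "\<forall>x\<in>I - {0}. \<not> is_upper_end I x \<longrightarrow> f (complex_of_real x) = 0"
        using zero_propagates[OF x(1)] re(1) by simp
    qed
    show ?K
    proof (intro ballI impI)
      fix x assume x: "x \<in> I - {0}" "\<not> is_upper_end I x"
      then have "continuous (at x within I) g"
        using J_nonneg[of x] by (intro continuous_within) auto
      then have "continuous (at x within I - {0}) g"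
        by (rule continuous_within_subset) blast
      then have "continuous (at x within I - {0}) (\<lambda>t. complex_of_real (g t))"
        by (rule continuous_of_real)
      \<comment> \<open>The two functions agree on all of \<open>I\<close>, so the radius 1 is
        arbitrary.\<close>
      then show "continuous (at x within I - {0}) (\<lambda>t. f (complex_of_real t))"
        by (rule continuous_transform_within[where \<delta> = 1]) (use x re(1) in auto)
    qed
  qed
  then show ?thesis using PC CP by blast
qed

end
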